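(* Let $G$ be a finite simple graph. The following statements are equivalent: 1. $G$ is a closed graph; 2. $G$ has a closed ordering; 3. $G$ has a proper interval ordering; 4. $G$ is a proper interval graph.
   Context: Graphs are finite and simple, with vertex set $V(G)$ and edge set $E(G)$; $[n]=\{1,\ldots,n\}$. Vertex ordering: a vertex ordering (labeling) of an $n$-vertex graph $G$ is a bijection $\sigma: V(G)\to [n]$; write $u<_\sigma v$ if $\sigma(u)<\sigma(v)$, so that the vertices can be listed as $v_1<_\sigma v_2<_\sigma\cdots<_\sigma v_n$. Closed graph: a graph on the vertex set $[n]$ is closed with respect to the given labeling if for all edges $\{i,j\},\{k,\ell\}\in E(G)$ with $i<j$ and $k<\ell$, one has $\{j,\ell\}\in E(G)$ if $i=k$ but $j\neq \ell$, and $\{i,k\}\in E(G)$ if $j=\ell$ but $i\neq k$. A graph $G$ is a closed graph if there exists a labeling of its vertices by $[n]$ for which it is closed. Closed ordering: a vertex ordering $\sigma$ of $G$, with $v_1<_\sigma\cdots<_\sigma v_n$, is closed if for all edges $\{v_i,v_j\}$ and $\{v_k,v_\ell\}$ with $i<j$ and $k<\ell$, one has $\{v_j,v_\ell\}\in E(G)$ if $i=k$ but $j\ne\ell$, and $\{v_i,v_k\}\in E(G)$ if $j=\ell$ but $i\neq k$. Proper interval ordering: a vertex ordering $\sigma$ of $G$ such that for every triple $u,v,w$ of vertices with $u<_\sigma v<_\sigma w$ and $\{u,w\}\in E(G)$, one has $\{u,v\},\{v,w\}\in E(G)$. Interval graph: a graph $G$ such that to each vertex $v\in V(G)$ one can associate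 a closed interval $I_v=[\ell_v,r_v]$ of the real line such that two distinct vertices $u,v$ are adjacent if and only if $I_u\cap I_v\neq\emptyset$; the family $\{I_v\}_{v\in V(G)}$ is an interval representation of $G$. A proper interval graph is a graph having an interval representation in which no interval properly contains another interval of the family. *)

theory Defs
  imports Complex_Main
begin

definition finite_simple_graph :: "'a set \<Rightarrow> 'a set set \<Rightarrow> bool" where
  "finite_simple_graph V E \<longleftrightarrow> finite V \<and> (\<forall>e\<in>E. e \<subseteq> V \<and> card e = 2)"

definition vertex_ordering :: "'a set \<Rightarrow> ('a \<Rightarrow> nat) \<Rightarrow> bool" where
  "vertex_ordering V \<sigma> \<longleftrightarrow> bij_betw \<sigma> V {1..card V}"

text \<open>Closedness of a graph whose vertices are already the integers 1, ..., n, with respect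
  to this given labeling; only the edge set matters.\<close>

definition closed_labeled :: "nat set set \<Rightarrow> bool" where
  "closed_labeled E \<longleftrightarrow>
     (\<forall>i j k l. {i, j} \<in> E \<and> {k, l} \<in> E \<and> i < j \<and> k < l \<longrightarrow>
        (i = k \<and> j \<noteq> l \<longrightarrow> {j, l} \<in> E) \<and> (j = l \<and> i \<noteq> k \<longrightarrow> {i, k} \<in> E))"

text \<open>The graph is transported along the labeling: the edge \<open>{u, v}\<close> becomes
  \<open>{\<sigma> u, \<sigma> v}\<close>.\<close>

definition closed_graph :: "'a set \<Rightarrow> 'a set set \<Rightarrow> bool" where
  "closed_graph V E \<longleftrightarrow> (\<exists>\<sigma>. vertex_ordering V \<sigma> \<and> closed_labeled ((`) \<sigma> ` E))"

text \<open>Here \<open>v i\<close> is the \<open>i\<close>-th vertex in the list of vertices sorted by the ordering.\<close>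

definition closed_ordering :: "'a set \<Rightarrow> 'a set set \<Rightarrow> ('a \<Rightarrow> nat) \<Rightarrow> bool" where
  "closed_ordering V E \<sigma> \<longleftrightarrow> vertex_ordering V \<sigma> \<and>
     (let v = inv_into V \<sigma>; n = card V in
       \<forall>i\<in>{1..n}. \<forall>j\<in>{1..n}. \<forall>k\<in>{1..n}. \<forall>l\<in>{1..n}.
         {v i, v j} \<in> E \<and> {v k, v l} \<in> E \<and> i < j \<and> k < l \<longrightarrow>
           (i = k \<and> j \<noteq> l \<longrightarrow> {v j, v l} \<in> E) \<and> (j = l \<and> i \<noteq> k \<longrightarrow> {v i, v k} \<in> E))"

definition proper_interval_ordering :: "'a set \<Rightarrow> 'a set set \<Rightarrow> ('a \<Rightarrow> nat) \<Rightarrow> bool" where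
  "proper_interval_ordering V E \<sigma> \<longleftrightarrow> vertex_ordering V \<sigma> \<and>
     (\<forall>u\<in>V. \<forall>v\<in>V. \<forall>w\<in>V. \<sigma> u < \<sigma> v \<and> \<sigma> v < \<sigma> w \<and> {u, w} \<in> E \<longrightarrow>
        {u, v} \<in> E \<and> {v, w} \<in> E)"

text \<open>Intervals are nonempty (\<open>l v \<le> r v\<close>); without this requirement, empty intervals could be
  assigned to isolated vertices.\<close>

definition interval_representation ::
    "'a set \<Rightarrow> 'a set set \<Rightarrow> ('a \<Rightarrow> real) \<Rightarrow> ('a \<Rightarrow> real) \<Rightarrow> bool" where
  "interval_representation V E l r \<longleftrightarrow> (\<forall>v\<in>V. l v \<le> r v) \<and>
     (\<forall>u\<in>V. \<forall>v\<in>V. u \<noteq> v \<longrightarrow> ({u, v} \<in> E \<longleftrightarrow> {l u..r u} \<inter> {l v..r v} \<noteq> {}))"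

text \<open>Distinct vertices may share the same interval; only strict containment is excluded.\<close>

definition proper_interval_graph :: "'a set \<Rightarrow> 'a set set \<Rightarrow> bool" where
  "proper_interval_graph V E \<longleftrightarrow> (\<exists>l r. interval_representation V E l r \<and>
     (\<forall>u\<in>V. \<forall>v\<in>V. \<not> {l u..r u} \<subset> {l v..r v}))"

end

theory Submission
  imports Defs
begin

text \<open>A closed ordering need not be a proper interval ordering when the graph is disconnected, so
  its vertices are regrouped by connected component. Inside a component, closedness lets every walk
  be straightened to a monotone one; following an increasing walk from \<open>u\<close> to \<open>v\<close> below an edge
  \<open>{u, w}\<close>, each vertex on it is adjacent to \<open>w\<close>. Conversely, a proper interval ordering
  \<open>\<sigma>\<close> is represented by the intervals from \<open>\<sigma> v\<close> to the last label in the closed neighbourhood of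
  \<open>v\<close>, perturbed by less than \<open>1\<close> so that right ends increase strictly, and sorting a proper
  representation by left ends also sorts it by right ends.\<close>

section \<open>Sorting a finite set by a key\<close>

text \<open>An element with the largest key gets the last label, and the rest is labelled by
  induction on the cardinality. Equal keys may be ordered arbitrarily, hence only a weak
  inequality.\<close>

lemma finite_sorting_bijection:
  fixes f :: "'a \<Rightarrow> 'b::linorder"
  assumes "finite V"
  shows "\<exists>\<sigma>. bij_betw \<sigma> V {1..card V} \<and> (\<forall>u\<in>V. \<forall>v\<in>V. \<sigma> u < \<sigma> v \<longrightarrow> f u \<le> f v)"
  using assms
proof (induction "card V" arbitrary: V)
  case 0
  then show ?case by (auto simp: bij_betw_def)
next
  case (Suc n)
  then have "V \<noteq> {}" "finite (f ` V)" by auto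
  then have "Max (f ` V) \<in> f ` V" by simp
  then obtain m where m: "m \<in> V" "f m = Max (f ` V)" by auto
  have top: "f v \<le> f m" if "v \<in> V" for v
    using that m \<open>finite (f ` V)\<close> by simp
  have card: "card (V - {m}) = n" using Suc.hyps(2) Suc.prems m by simp
  obtain \<tau> where \<tau>: "bij_betw \<tau> (V - {m}) {1..n}"
    and sorted: "\<forall>u\<in>V - {m}. \<forall>v\<in>V - {m}. \<tau> u < \<tau> v \<longrightarrow> f u \<le> f v"
    using Suc.hyps(1)[of "V - {m}"] card Suc.prems by auto
  define \<sigma> where "\<sigma> = \<tau>(m := Suc n)"
  have "bij_betw \<sigma> (V - {m}) {1..n}"
    using \<tau> by (subst bij_betw_cong[where g = \<tau>]) (auto simp: \<sigma>_def)
  then have "bij_betw \<sigma> (insert m (V - {m})) (insert (Suc n) {1..n})"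
    by (subst insert_is_Un[of m], subst insert_is_Un[of "Suc n"], intro bij_betw_combine)
       (auto simp: \<sigma>_def bij_betw_def)
  moreover have "insert m (V - {m}) = V" using m by auto
  moreover have "insert (Suc n) {1..n} = {1..card V}" using Suc.hyps(2) by auto
  ultimately have bij: "bij_betw \<sigma> V {1..card V}" by simp
  have "f u \<le> f v" if "u \<in> V" "v \<in> V" "\<sigma> u < \<sigma> v" for u v
  proof (cases "v = m")
    case True
    then show ?thesis using top that by simp
  next
    case False
    \<comment> \<open>All vertices other than \<open>m\<close> have labels at most \<open>n\<close>,
      so \<open>m\<close>, labelled \<open>Suc n\<close>, cannot precede \<open>v\<close>.\<close>
    then have "\<tau> v \<le> n" using bij_betwE[OF \<tau>] that by auto
    with False that have "u \<noteq> m" by (auto simp: \<sigma>_def)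
    with False that sorted show ?thesis by (auto simp: \<sigma>_def)
  qed
  with bij show ?case by blast
qed

section \<open>Closedness as a condition on two edges with a common end\<close>

text \<open>The two clauses of closedness merge into one: the common end \<open>a\<close> lies below
  both other ends or above both. A relation \<open>R\<close> instead of a labeling makes the
  condition visibly invariant under reversing the order.\<close>

definition closed_wrt :: "('a \<Rightarrow> 'a \<Rightarrow> bool) \<Rightarrow> 'a set set \<Rightarrow> bool" where
  "closed_wrt R E \<longleftrightarrow> (\<forall>a b c. {a, b} \<in> E \<and> {a, c} \<in> E \<and> b \<noteq> c \<and>
     (R a b \<and> R a c \<or> R b a \<and> R c a) \<longrightarrow> {b, c} \<in> E)"

lemma closed_wrtD:
  assumes "closed_wrt R E" "{a, b} \<in> E" "{a, c} \<in> E" "b \<noteq> c" "R a b \<and> R a c \<or> R b a \<and> R c a"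
  shows "{b, c} \<in> E"
  using assms unfolding closed_wrt_def by blast

lemma finite_simple_graph_edgeD:
  assumes "finite_simple_graph V E" "{a, b} \<in> E"
  shows "a \<in> V" "b \<in> V" "a \<noteq> b"
  using assms by (force simp: finite_simple_graph_def)+

lemma doubleton_mem_image_edges:
  assumes "finite_simple_graph V E"
  shows "{i, j} \<in> (`) \<sigma> ` E \<longleftrightarrow> (\<exists>a b. i = \<sigma> a \<and> j = \<sigma> b \<and> {a, b} \<in> E)"
proof
  assume "{i, j} \<in> (`) \<sigma> ` E"
  then obtain e where e: "e \<in> E" "{i, j} = \<sigma> ` e" by auto
  then obtain a b where "e = {a, b}"
    using assms by (auto simp: finite_simple_graph_def card_2_iff)
  with e have "{a, b} \<in> E" "{b, a} \<in> E" "i = \<sigma> a \<and> j = \<sigma> b \<or> i = \<sigma> b \<and> j = \<sigma> a"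
    by (auto simp: doubleton_eq_iff insert_commute)
  then show "\<exists>a b. i = \<sigma> a \<and> j = \<sigma> b \<and> {a, b} \<in> E" by blast
next
  assume "\<exists>a b. i = \<sigma> a \<and> j = \<sigma> b \<and> {a, b} \<in> E"
  then obtain a b where "i = \<sigma> a" "j = \<sigma> b" "{a, b} \<in> E" by blast
  then show "{i, j} \<in> (`) \<sigma> ` E" by (intro image_eqI[where x = "{a, b}"]) auto
qed

text \<open>Injectivity makes labels as good as vertices: distinct vertices keep distinct labels,
  and an edge between labels comes from an edge between the very vertices that carry them.\<close>

lemma closed_labeled_iff_closed_wrt:
  assumes G: "finite_simple_graph V E" and inj: "inj_on \<sigma> V"
  shows "closed_labeled ((`) \<sigma> ` E) \<longleftrightarrow> closed_wrt (\<lambda>x y. \<sigma> x < \<sigma> y) E"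
proof
  note mem = doubleton_mem_image_edges[OF G]
  note edgeD = finite_simple_graph_edgeD[OF G]
  assume labeled: "closed_labeled ((`) \<sigma> ` E)"
  have L: "(i = k \<and> j \<noteq> l \<longrightarrow> {j, l} \<in> (`) \<sigma> ` E) \<and> (j = l \<and> i \<noteq> k \<longrightarrow> {i, k} \<in> (`) \<sigma> ` E)"
    if "{i, j} \<in> (`) \<sigma> ` E" "{k, l} \<in> (`) \<sigma> ` E" "i < j" "k < l" for i j k l
    by (rule labeled[unfolded closed_labeled_def, THEN spec, THEN spec, THEN spec, THEN spec, THEN mp])
       (intro conjI that)
  show "closed_wrt (\<lambda>x y. \<sigma> x < \<sigma> y) E"
    unfolding closed_wrt_def
  proof (intro allI impI, elim conjE)
    fix a b c
    assume ab: "{a, b} \<in> E" and ac: "{a, c} \<in> E" and "b \<noteq> c"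
      and ord: "\<sigma> a < \<sigma> b \<and> \<sigma> a < \<sigma> c \<or> \<sigma> b < \<sigma> a \<and> \<sigma> c < \<sigma> a"
    have "\<sigma> b \<noteq> \<sigma> c" using \<open>b \<noteq> c\<close> inj ab ac edgeD by (meson inj_onD)
    moreover have "{\<sigma> a, \<sigma> b} \<in> (`) \<sigma> ` E" "{\<sigma> a, \<sigma> c} \<in> (`) \<sigma> ` E"
      using ab ac unfolding mem by blast+
    moreover from this have "{\<sigma> b, \<sigma> a} \<in> (`) \<sigma> ` E" "{\<sigma> c, \<sigma> a} \<in> (`) \<sigma> ` E"
      by (simp_all only: insert_commute)
    ultimately have "{\<sigma> b, \<sigma> c} \<in> (`) \<sigma> ` E"
      using ord L[of "\<sigma> a" "\<sigma> b" "\<sigma> a" "\<sigma> c"] L[of "\<sigma> b" "\<sigma> a" "\<sigma> c" "\<sigma> a"] by blast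
    then obtain x y where xy: "\<sigma> b = \<sigma> x" "\<sigma> c = \<sigma> y" "{x, y} \<in> E" unfolding mem by blast
    then have "b = x" "c = y" using inj ab ac edgeD by (meson inj_onD)+
    with xy show "{b, c} \<in> E" by simp
  qed
next
  note mem = doubleton_mem_image_edges[OF G]
  note edgeD = finite_simple_graph_edgeD[OF G]
  assume C: "closed_wrt (\<lambda>x y. \<sigma> x < \<sigma> y) E"
  show "closed_labeled ((`) \<sigma> ` E)"
    unfolding closed_labeled_def
  proof (intro allI impI, elim conjE)
    fix i j k l
    assume "{i, j} \<in> (`) \<sigma> ` E" "{k, l} \<in> (`) \<sigma> ` E" and lt: "i < j" "k < l"
    then obtain a b c d where e: "i = \<sigma> a" "j = \<sigma> b" "{a, b} \<in> E" "k = \<sigma> c" "l = \<sigma> d" "{c, d} \<in> E"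
      unfolding mem by blast
    have eq: "a = c" if "i = k" using that e inj edgeD by (meson inj_onD)
    have eq': "b = d" if "j = l" using that e inj edgeD by (meson inj_onD)
    have "{b, d} \<in> E" if "i = k" "j \<noteq> l"
      using closed_wrtD[OF C, of a b d] eq that e lt by auto
    moreover have "{a, c} \<in> E" if "j = l" "i \<noteq> k"
      using closed_wrtD[OF C, of b a c] eq' that e lt by (auto simp: insert_commute)
    ultimately show "(i = k \<and> j \<noteq> l \<longrightarrow> {j, l} \<in> (`) \<sigma> ` E) \<and> (j = l \<and> i \<noteq> k \<longrightarrow> {i, k} \<in> (`) \<sigma> ` E)"
      using e unfolding mem by blast
  qed
qed

text \<open>The listing \<open>v\<close> and the ordering \<open>\<sigma>\<close> are mutually
  inverse between positions and vertices. All ends of edges lie in \<open>V\<close>, so the range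
  restriction on positions misses no edge.\<close>

lemma closed_ordering_iff_closed_wrt:
  assumes G: "finite_simple_graph V E"
  shows "closed_ordering V E \<sigma> \<longleftrightarrow> vertex_ordering V \<sigma> \<and> closed_wrt (\<lambda>x y. \<sigma> x < \<sigma> y) E"
proof (cases "vertex_ordering V \<sigma>")
  case False
  then show ?thesis by (simp add: closed_ordering_def)
next
  case True
  then have bij: "bij_betw \<sigma> V {1..card V}" by (simp add: vertex_ordering_def)
  define v where "v = inv_into V \<sigma>"
  note edgeD = finite_simple_graph_edgeD[OF G]
  have v\<sigma>: "v (\<sigma> x) = x" if "x \<in> V" for x
    using that bij by (simp add: v_def bij_betw_def)
  have \<sigma>v: "\<sigma> (v i) = i" if "i \<in> {1..card V}" for i
    using that bij by (simp add: v_def bij_betw_inv_into_right)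
  have \<sigma>mem: "\<sigma> x \<in> {1..card V}" if "x \<in> V" for x
    using that bij by (meson bij_betwE)
  show ?thesis
  proof
    assume "closed_ordering V E \<sigma>"
    then have C: "(i = k \<and> j \<noteq> l \<longrightarrow> {v j, v l} \<in> E) \<and> (j = l \<and> i \<noteq> k \<longrightarrow> {v i, v k} \<in> E)"
      if "i \<in> {1..card V}" "j \<in> {1..card V}" "k \<in> {1..card V}" "l \<in> {1..card V}"
        "{v i, v j} \<in> E" "{v k, v l} \<in> E" "i < j" "k < l" for i j k l
      using that unfolding closed_ordering_def Let_def v_def by blast
    have "closed_wrt (\<lambda>x y. \<sigma> x < \<sigma> y) E"
      unfolding closed_wrt_def
    proof (intro allI impI, elim conjE)
      fix a b c
      assume ab: "{a, b} \<in> E" and ac: "{a, c} \<in> E" and "b \<noteq> c"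
        and ord: "\<sigma> a < \<sigma> b \<and> \<sigma> a < \<sigma> c \<or> \<sigma> b < \<sigma> a \<and> \<sigma> c < \<sigma> a"
      have V: "a \<in> V" "b \<in> V" "c \<in> V" using ab ac edgeD by auto
      then have "\<sigma> b \<noteq> \<sigma> c" using \<open>b \<noteq> c\<close> v\<sigma> by metis
      then show "{b, c} \<in> E"
        using ord C[of "\<sigma> a" "\<sigma> b" "\<sigma> a" "\<sigma> c"] C[of "\<sigma> b" "\<sigma> a" "\<sigma> c" "\<sigma> a"] V ab ac
          \<sigma>mem[OF V(1)] \<sigma>mem[OF V(2)] \<sigma>mem[OF V(3)]
        by (auto simp: v\<sigma> insert_commute)
    qed
    with True show "vertex_ordering V \<sigma> \<and> closed_wrt (\<lambda>x y. \<sigma> x < \<sigma> y) E" by simp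
  next
    assume "vertex_ordering V \<sigma> \<and> closed_wrt (\<lambda>x y. \<sigma> x < \<sigma> y) E"
    then have C: "closed_wrt (\<lambda>x y. \<sigma> x < \<sigma> y) E" by simp
    have "(i = k \<and> j \<noteq> l \<longrightarrow> {v j, v l} \<in> E) \<and> (j = l \<and> i \<noteq> k \<longrightarrow> {v i, v k} \<in> E)"
      if I: "i \<in> {1..card V}" "j \<in> {1..card V}" "k \<in> {1..card V}" "l \<in> {1..card V}"
        and e: "{v i, v j} \<in> E" "{v k, v l} \<in> E" and lt: "i < j" "k < l" for i j k l
    proof (intro conjI impI; elim conjE)
      assume "i = k" "j \<noteq> l"
      moreover from this have "v j \<noteq> v l" using \<sigma>v I by metis
      ultimately show "{v j, v l} \<in> E"
        using closed_wrtD[OF C, of "v i" "v j" "v l"] e lt I \<sigma>v by metis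
    next
      assume "j = l" "i \<noteq> k"
      moreover from this have "v i \<noteq> v k" using \<sigma>v I by metis
      ultimately show "{v i, v k} \<in> E"
        using closed_wrtD[OF C, of "v j" "v i" "v k"] e lt I \<sigma>v by (metis insert_commute)
    qed
    with True show "closed_ordering V E \<sigma>"
      unfolding closed_ordering_def Let_def v_def by blast
  qed
qed

lemma closed_graph_iff_closed_ordering:
  assumes "finite_simple_graph V E"
  shows "closed_graph V E \<longleftrightarrow> (\<exists>\<sigma>. closed_ordering V E \<sigma>)"
  unfolding closed_graph_def closed_ordering_iff_closed_wrt[OF assms]
  using closed_labeled_iff_closed_wrt[OF assms]
  by (metis bij_betw_imp_inj_on vertex_ordering_def)

section \<open>Monotone walks\<close>

text \<open>As a relation, so that its reflexive-transitive closure expresses being joined by a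
  walk; the closure of \<open>upward\<close> below likewise expresses rising walks.\<close>

definition adjacency :: "'a set set \<Rightarrow> ('a \<times> 'a) set" where
  "adjacency E = {(x, y). {x, y} \<in> E}"

definition upward :: "('a \<Rightarrow> 'a \<Rightarrow> bool) \<Rightarrow> 'a set set \<Rightarrow> ('a \<times> 'a) set" where
  "upward R E = {(x, y). {x, y} \<in> E \<and> R x y}"

lemma sym_rtrancl_adjacency: "(x, y) \<in> (adjacency E)\<^sup>* \<Longrightarrow> (y, x) \<in> (adjacency E)\<^sup>*"
  by (rule symD[OF sym_rtrancl]) (auto simp: sym_def adjacency_def insert_commute)

text \<open>Two consecutive edges forming a local maximum can be shortcut by an edge between their lower
  ends; repeating this removes every change of direction.\<close>

lemma upward_walk_then_down:
  assumes C: "closed_wrt R E" and total: "\<And>x y. {x, y} \<in> E \<Longrightarrow> R x y \<or> R y x"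
    and "(u, x) \<in> (upward R E)\<^sup>*" "{x, y} \<in> E" "R y x"
  shows "(u, y) \<in> (upward R E)\<^sup>* \<or> (y, u) \<in> (upward R E)\<^sup>*"
  using assms(3-)
proof (induction arbitrary: y rule: rtrancl_induct)
  case base
  then show ?case by (auto simp: upward_def insert_commute)
next
  case (step x' x)
  show ?case
  proof (cases "y = x'")
    case True
    then show ?thesis using step by simp
  next
    case False
    then have e: "{x', y} \<in> E"
      using step closed_wrtD[OF C, of x x' y] by (auto simp: upward_def insert_commute)
    \<comment> \<open>Either the shortcut edge rises and extends the walk ending at
      \<open>x'\<close>, or it falls and the induction hypothesis for that walk applies.\<close>
    from total[OF this] show ?thesis
    proof
      assume "R x' y"
      with e have "(x', y) \<in> upward R E" by (simp add: upward_def)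
      with step show ?thesis by (meson rtrancl.rtrancl_into_rtrancl)
    qed (use e step in blast)
  qed
qed

lemma upward_converse: "upward (\<lambda>x y. R y x) E = (upward R E)\<inverse>"
  by (auto simp: upward_def insert_commute)

lemma closed_wrt_converse: "closed_wrt (\<lambda>x y. R y x) E \<longleftrightarrow> closed_wrt R E"
  by (auto simp: closed_wrt_def)

text \<open>The walk is read edge by edge while a monotone replacement is maintained. An edge in the
  current direction is appended; a change of direction is absorbed by
  \<open>upward_walk_then_down\<close>.\<close>

lemma connected_imp_monotone_walk:
  assumes C: "closed_wrt R E" and total: "\<And>x y. {x, y} \<in> E \<Longrightarrow> R x y \<or> R y x"
    and "(u, v) \<in> (adjacency E)\<^sup>*"
  shows "(u, v) \<in> (upward R E)\<^sup>* \<or> (v, u) \<in> (upward R E)\<^sup>*"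
  using assms(3)
proof (induction rule: rtrancl_induct)
  case base
  then show ?case by simp
next
  case (step x y)
  then have e: "{x, y} \<in> E" by (simp add: adjacency_def)
  from step.IH show ?case
  proof
    assume up: "(u, x) \<in> (upward R E)\<^sup>*"
    show ?thesis
    proof (cases "R y x")
      case True
      then show ?thesis using upward_walk_then_down[OF C total up e] by blast
    next
      case False
      then have "(x, y) \<in> upward R E" using total e by (auto simp: upward_def)
      with up show ?thesis by (meson rtrancl.rtrancl_into_rtrancl)
    qed
  next
    assume down: "(x, u) \<in> (upward R E)\<^sup>*"
    show ?thesis
    proof (cases "R x y")
      case True
      \<comment> \<open>Reversing the order turns a falling walk from \<open>u\<close> to
        \<open>x\<close> with a final rise into a rising one with a final descent.\<close>
      have "(u, y) \<in> (upward (\<lambda>x y. R y x) E)\<^sup>* \<or> (y, u) \<in> (upward (\<lambda>x y. R y x) E)\<^sup>*"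
      proof (rule upward_walk_then_down[where x = x])
        show "closed_wrt (\<lambda>x y. R y x) E" using C by (simp only: closed_wrt_converse[of R])
        show "(u, x) \<in> (upward (\<lambda>x y. R y x) E)\<^sup>*"
          using down by (simp add: upward_converse[of R] rtrancl_converse)
        show "R b a \<or> R a b" if "{a, b} \<in> E" for a b using total[OF that] by blast
      qed (fact e True)+
      then show ?thesis by (auto simp: upward_converse[of R] rtrancl_converse)
    next
      case False
      then have "(y, x) \<in> upward R E" using total e by (auto simp: upward_def insert_commute)
      with down show ?thesis by (meson converse_rtrancl_into_rtrancl)
    qed
  qed
qed

lemma upward_rtrancl_le:
  fixes \<sigma> :: "'a \<Rightarrow> 'b::order"
  assumes "(u, v) \<in> (upward (\<lambda>x y. \<sigma> x < \<sigma> y) E)\<^sup>*"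
  shows "\<sigma> u \<le> \<sigma> v"
  using assms by induction (auto simp: upward_def intro: order.trans less_imp_le)

lemma closed_wrt_connected_between:
  fixes \<sigma> :: "'a \<Rightarrow> 'b::linorder"
  assumes C: "closed_wrt (\<lambda>x y. \<sigma> x < \<sigma> y) E" and neq: "\<And>x y. {x, y} \<in> E \<Longrightarrow> \<sigma> x \<noteq> \<sigma> y"
    and con: "(u, v) \<in> (adjacency E)\<^sup>*" and uw: "{u, w} \<in> E" and lt: "\<sigma> u < \<sigma> v" "\<sigma> v < \<sigma> w"
  shows "{u, v} \<in> E \<and> {v, w} \<in> E"
proof -
  \<comment> \<open>A rising walk from \<open>v\<close> to \<open>u\<close> would contradict
    \<open>\<sigma> u < \<sigma> v\<close>.\<close>
  have "(u, v) \<in> (upward (\<lambda>x y. \<sigma> x < \<sigma> y) E)\<^sup>*"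
    using connected_imp_monotone_walk[OF C _ con] neq upward_rtrancl_le lt
    by (metis leD linorder_neqE)
  \<comment> \<open>The bound becomes a premise so that the induction runs along the walk: a vertex
    \<open>x\<close> before \<open>y\<close> is also below \<open>w\<close>, and \<open>y\<close>
    and \<open>w\<close> are then both upper neighbours of \<open>x\<close>.\<close>
  then have "\<sigma> v < \<sigma> w \<longrightarrow> {v, w} \<in> E"
  proof (induction rule: rtrancl_induct)
    case (step x y)
    then have "\<sigma> x < \<sigma> y" "{x, y} \<in> E" by (auto simp: upward_def)
    with step.IH show ?case
      using closed_wrtD[OF C, of x y w] by fastforce
  qed (use uw in simp)
  with lt have vw: "{v, w} \<in> E" by simp
  \<comment> \<open>Now \<open>u\<close> and \<open>v\<close> are both lower neighbours of
    \<open>w\<close>.\<close>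
  moreover have "{u, v} \<in> E"
    using closed_wrtD[OF C, of w u v] uw vw lt by (force simp: insert_commute)
  ultimately show ?thesis by simp
qed

section \<open>Closed orderings versus proper interval orderings\<close>

lemma closed_wrt_imp_proper_interval_ordering:
  assumes G: "finite_simple_graph V E" and \<sigma>: "vertex_ordering V \<sigma>"
    and C: "closed_wrt (\<lambda>x y. \<sigma> x < \<sigma> y) E"
  shows "\<exists>\<tau>. proper_interval_ordering V E \<tau>"
proof -
  have fin: "finite V" using G by (simp add: finite_simple_graph_def)
  have inj: "inj_on \<sigma> V" and bound: "\<And>v. v \<in> V \<Longrightarrow> \<sigma> v \<le> card V"
    using \<sigma> by (auto simp: vertex_ordering_def bij_betw_def)
  \<comment> \<open>\<open>K v\<close> is the component of \<open>v\<close>, and its least label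
    \<open>c v\<close> identifies it. The key encodes the lexicographic order by \<open>c v\<close>,
    then \<open>\<sigma> v\<close>: the factor \<open>Suc (card V)\<close> exceeds every
    label.\<close>
  define K where "K v = {x \<in> V. (v, x) \<in> (adjacency E)\<^sup>*}" for v
  define c where "c v = Min (\<sigma> ` K v)" for v
  define key where "key v = c v * Suc (card V) + \<sigma> v" for v
  have K_eq: "K u = K v" if "(u, v) \<in> (adjacency E)\<^sup>*" for u v
    using that sym_rtrancl_adjacency[OF that] by (auto simp: K_def intro: rtrancl_trans)
  have c_mem: "\<exists>x \<in> V. (v, x) \<in> (adjacency E)\<^sup>* \<and> \<sigma> x = c v" if "v \<in> V" for v
  proof -
    have "finite (\<sigma> ` K v)" "\<sigma> ` K v \<noteq> {}" using fin that by (auto simp: K_def)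
    then have "c v \<in> \<sigma> ` K v" unfolding c_def by (rule Min_in)
    then show ?thesis by (auto simp: K_def)
  qed
  have c_eqD: "(u, v) \<in> (adjacency E)\<^sup>*" if V: "u \<in> V" "v \<in> V" and eq: "c u = c v" for u v
  proof -
    obtain x y where "x \<in> V" "(u, x) \<in> (adjacency E)\<^sup>*" "\<sigma> x = c u"
      and "y \<in> V" "(v, y) \<in> (adjacency E)\<^sup>*" "\<sigma> y = c v"
      using c_mem[OF V(1)] c_mem[OF V(2)] by blast
    moreover from this have "x = y" using inj eq by (metis inj_onD)
    ultimately show ?thesis using sym_rtrancl_adjacency by (metis rtrancl_trans)
  qed
  have c_le: "c u \<le> c v" if "v \<in> V" "key u \<le> key v" for u v
  proof (rule ccontr)
    assume "\<not> c u \<le> c v"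
    \<comment> \<open>A gap of one in \<open>c\<close> already outweighs any value of
      \<open>\<sigma> v\<close>.\<close>
    then have "Suc (c v) * Suc (card V) \<le> c u * Suc (card V)" by (intro mult_le_mono1) simp
    then show False using that bound[of v] by (simp add: key_def)
  qed
  obtain \<tau> where \<tau>: "vertex_ordering V \<tau>"
    and sorted: "\<And>u v. u \<in> V \<Longrightarrow> v \<in> V \<Longrightarrow> \<tau> u < \<tau> v \<Longrightarrow> key u \<le> key v"
    using finite_sorting_bijection[OF fin, of key] unfolding vertex_ordering_def by blast
  have "{u, v} \<in> E \<and> {v, w} \<in> E"
    if V: "u \<in> V" "v \<in> V" "w \<in> V" and lt: "\<tau> u < \<tau> v" "\<tau> v < \<tau> w" and uw: "{u, w} \<in> E" for u v w
  proof -
    have "key u \<le> key v" "key v \<le> key w" using sorted V lt by auto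
    moreover have "c u = c w"
      unfolding c_def using uw by (subst K_eq[of u w]) (auto simp: adjacency_def)
    \<comment> \<open>The edge puts \<open>u\<close> and \<open>w\<close> in one component, and
      \<open>v\<close>, sorted between them, is forced into it.\<close>
    ultimately have c: "c u = c v" "c v = c w" using c_le V by (metis antisym)+
    have "\<sigma> u \<le> \<sigma> v" "\<sigma> v \<le> \<sigma> w"
      using \<open>key u \<le> key v\<close> \<open>key v \<le> key w\<close> c by (auto simp: key_def)
    moreover have "u \<noteq> v" "v \<noteq> w" using lt by auto
    ultimately have "\<sigma> u < \<sigma> v" "\<sigma> v < \<sigma> w"
      using V inj by (metis inj_onD le_neq_implies_less)+
    moreover have "\<sigma> x \<noteq> \<sigma> y" if "{x, y} \<in> E" for x y
      using finite_simple_graph_edgeD[OF G that] inj by (meson inj_onD)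
    ultimately show ?thesis
      using closed_wrt_connected_between[OF C] c_eqD c V uw by metis
  qed
  with \<tau> show ?thesis unfolding proper_interval_ordering_def by blast
qed

text \<open>Of two neighbours on the same side of a vertex, the nearer lies between that vertex and
  the farther one, so betweenness joins the two neighbours.\<close>

lemma proper_interval_ordering_imp_closed_wrt:
  assumes G: "finite_simple_graph V E" and P: "proper_interval_ordering V E \<sigma>"
  shows "closed_wrt (\<lambda>x y. \<sigma> x < \<sigma> y) E"
  unfolding closed_wrt_def
proof (intro allI impI, elim conjE)
  fix a b c
  assume e: "{a, b} \<in> E" "{a, c} \<in> E" and "b \<noteq> c"
    and ord: "\<sigma> a < \<sigma> b \<and> \<sigma> a < \<sigma> c \<or> \<sigma> b < \<sigma> a \<and> \<sigma> c < \<sigma> a"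
  have V: "a \<in> V" "b \<in> V" "c \<in> V" using finite_simple_graph_edgeD[OF G] e by auto
  have "inj_on \<sigma> V"
    using P by (auto simp: proper_interval_ordering_def vertex_ordering_def bij_betw_def)
  then have "\<sigma> b < \<sigma> c \<or> \<sigma> c < \<sigma> b" using V \<open>b \<noteq> c\<close> by (meson inj_onD linorder_neqE_nat)
  moreover have "{b, a} \<in> E" "{c, a} \<in> E" using e by (simp_all only: insert_commute)
  ultimately have "{b, c} \<in> E \<or> {c, b} \<in> E"
    using P V e ord unfolding proper_interval_ordering_def by blast
  then show "{b, c} \<in> E" by (simp add: insert_commute)
qed

lemma closed_ordering_iff_proper_interval_ordering:
  assumes "finite_simple_graph V E"
  shows "(\<exists>\<sigma>. closed_ordering V E \<sigma>) \<longleftrightarrow> (\<exists>\<sigma>. proper_interval_ordering V E \<sigma>)"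
  using closed_wrt_imp_proper_interval_ordering[OF assms]
    proper_interval_ordering_imp_closed_wrt[OF assms]
  unfolding closed_ordering_iff_closed_wrt[OF assms]
  by (metis proper_interval_ordering_def)

section \<open>Proper interval orderings versus proper interval representations\<close>

lemma Icc_Int_Icc_nonempty_iff:
  fixes a b c d :: "'a::linorder"
  assumes "a \<le> c" "a \<le> b" "c \<le> d"
  shows "{a..b} \<inter> {c..d} \<noteq> {} \<longleftrightarrow> c \<le> b"
  using assms by auto

lemma proper_interval_ordering_imp_proper_interval_graph:
  assumes G: "finite_simple_graph V E" and P: "proper_interval_ordering V E \<sigma>"
  shows "proper_interval_graph V E"
proof -
  have fin: "finite V" using G by (simp add: finite_simple_graph_def)
  have inj: "inj_on \<sigma> V" and bound: "\<And>v. v \<in> V \<Longrightarrow> \<sigma> v \<le> card V"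
    using P by (auto simp: proper_interval_ordering_def vertex_ordering_def bij_betw_def)
  have between: "{u, v} \<in> E \<and> {v, w} \<in> E"
    if "u \<in> V" "v \<in> V" "w \<in> V" "\<sigma> u < \<sigma> v" "\<sigma> v < \<sigma> w" "{u, w} \<in> E" for u v w
    using P that unfolding proper_interval_ordering_def by blast
  define N where "N v = {x \<in> V. x = v \<or> {v, x} \<in> E}" for v
  define m where "m v = Max (\<sigma> ` N v)" for v
  have m_ge: "\<sigma> x \<le> m v" if "x \<in> N v" for x v
    unfolding m_def using fin that by (intro Max_ge) (auto simp: N_def)
  have m_mem: "\<exists>x \<in> N v. \<sigma> x = m v" if "v \<in> V" for v
  proof -
    have "finite (\<sigma> ` N v)" "\<sigma> ` N v \<noteq> {}" using fin that by (auto simp: N_def)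
    then have "m v \<in> \<sigma> ` N v" unfolding m_def by (rule Max_in)
    then show ?thesis by auto
  qed
  have m_self: "\<sigma> v \<le> m v" if "v \<in> V" for v using that by (intro m_ge) (simp add: N_def)
  have m_mono: "m u \<le> m v" if uv: "u \<in> V" "v \<in> V" "\<sigma> u < \<sigma> v" for u v
  proof -
    obtain w where w: "w \<in> N u" "\<sigma> w = m u" using m_mem uv by blast
    show ?thesis
    \<comment> \<open>If the last neighbour \<open>w\<close> of \<open>u\<close> lies beyond
      \<open>v\<close>, it is also a neighbour of \<open>v\<close>; otherwise \<open>m v\<close> is
      at least \<open>\<sigma> v\<close>, which suffices.\<close>
    proof (cases "\<sigma> v < \<sigma> w")
      case True
      then have "{v, w} \<in> E" using between[of u v w] uv w by (auto simp: N_def)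
      then show ?thesis using m_ge[of w v] w by (auto simp: N_def)
    next
      case False
      then show ?thesis using m_self[of v] uv w by simp
    qed
  qed
  have edge_iff: "{u, v} \<in> E \<longleftrightarrow> \<sigma> v \<le> m u" if uv: "u \<in> V" "v \<in> V" "\<sigma> u < \<sigma> v" for u v
  proof
    assume "{u, v} \<in> E"
    then show "\<sigma> v \<le> m u" using uv by (intro m_ge) (simp add: N_def)
  next
    assume le: "\<sigma> v \<le> m u"
    obtain w where w: "w \<in> N u" "\<sigma> w = m u" using m_mem uv by blast
    then have "w \<noteq> u" using le uv by auto
    with w have "w \<in> V" "{u, w} \<in> E" by (auto simp: N_def)
    \<comment> \<open>Either \<open>w\<close> is \<open>v\<close> itself, or \<open>v\<close> lies
      strictly between \<open>u\<close> and \<open>w\<close>.\<close>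
    then show "{u, v} \<in> E"
      using between[of u v w] uv w le inj by (metis inj_onD le_neq_implies_less)
  qed
  define l :: "'a \<Rightarrow> real" where "l v = real (\<sigma> v)" for v
  \<comment> \<open>The added fraction is below \<open>1\<close> because labels in \<open>V\<close>
    are at most \<open>card V\<close>. Left ends are integers, so comparing them with
    \<open>r u\<close> amounts to comparing them with \<open>m u\<close>, while ties among the
    \<open>m\<close> values are broken.\<close>
  define r :: "'a \<Rightarrow> real" where "r v = real (m v) + real (\<sigma> v) / real (Suc (card V))" for v
  have r_less: "r u < r v" if "u \<in> V" "v \<in> V" "\<sigma> u < \<sigma> v" for u v
    using m_mono[OF that] that unfolding r_def
    by (intro add_le_less_mono divide_strict_right_mono) auto
  have l_le_r: "l v \<le> r v" if "v \<in> V" for v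
    using m_self[OF that] by (simp add: l_def r_def add_increasing2)
  have l_le_r_iff: "l v \<le> r u \<longleftrightarrow> \<sigma> v \<le> m u" if "u \<in> V" for u v
  proof
    assume "l v \<le> r u"
    moreover have "real (\<sigma> u) / real (Suc (card V)) < 1" using bound[OF that] by simp
    ultimately have "real (\<sigma> v) < real (m u) + 1" unfolding l_def r_def by linarith
    then show "\<sigma> v \<le> m u" by linarith
  qed (simp add: l_def r_def add_increasing2)
  have meet: "{u, v} \<in> E \<longleftrightarrow> {l u..r u} \<inter> {l v..r v} \<noteq> {}"
    if uv: "u \<in> V" "v \<in> V" "\<sigma> u < \<sigma> v" for u v
  proof -
    have "{l u..r u} \<inter> {l v..r v} \<noteq> {} \<longleftrightarrow> l v \<le> r u"
      using uv l_le_r by (intro Icc_Int_Icc_nonempty_iff) (auto simp: l_def)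
    then show ?thesis using edge_iff[OF uv] l_le_r_iff uv by simp
  qed
  have "{u, v} \<in> E \<longleftrightarrow> {l u..r u} \<inter> {l v..r v} \<noteq> {}" if "u \<in> V" "v \<in> V" "u \<noteq> v" for u v
  proof -
    have "\<sigma> u < \<sigma> v \<or> \<sigma> v < \<sigma> u" using that inj by (meson inj_onD linorder_neqE_nat)
    then show ?thesis using meet[of u v] meet[of v u] that by (metis Int_commute insert_commute)
  qed
  then have "interval_representation V E l r"
    using l_le_r by (simp add: interval_representation_def)
  moreover have "\<not> {l u..r u} \<subset> {l v..r v}" if "u \<in> V" "v \<in> V" for u v
  proof
    assume sub: "{l u..r u} \<subset> {l v..r v}"
    \<comment> \<open>For nonempty intervals, containment compares both pairs of ends. Left ends
      give \<open>\<sigma> v \<le> \<sigma> u\<close>, strictly increasing right ends give the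
      converse, so the vertices coincide.\<close>
    then have "l v \<le> l u" "r u \<le> r v" using l_le_r that by (auto simp: psubset_eq)
    then have "\<sigma> v \<le> \<sigma> u" "\<not> \<sigma> v < \<sigma> u" using r_less[of v u] that by (fastforce simp: l_def)+
    then have "\<sigma> u = \<sigma> v" by simp
    then have "u = v" using inj that by (meson inj_onD)
    with sub show False by simp
  qed
  ultimately show ?thesis unfolding proper_interval_graph_def by blast
qed

lemma proper_interval_graph_imp_proper_interval_ordering:
  assumes G: "finite_simple_graph V E" and P: "proper_interval_graph V E"
  shows "\<exists>\<sigma>. proper_interval_ordering V E \<sigma>"
proof -
  obtain l r where "interval_representation V E l r"
    and "\<forall>u\<in>V. \<forall>v\<in>V. \<not> {l u..r u} \<subset> {l v..r v}"
    using P unfolding proper_interval_graph_def by blast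
  then have lr: "\<And>v. v \<in> V \<Longrightarrow> l v \<le> (r v :: real)"
    and meet: "\<And>u v. u \<in> V \<Longrightarrow> v \<in> V \<Longrightarrow> u \<noteq> v \<Longrightarrow>
      {u, v} \<in> E \<longleftrightarrow> {l u..r u} \<inter> {l v..r v} \<noteq> {}"
    and proper: "\<And>u v. u \<in> V \<Longrightarrow> v \<in> V \<Longrightarrow> \<not> {l u..r u} \<subset> {l v..r v}"
    unfolding interval_representation_def by auto
  have r_mono: "r u \<le> r v" if "u \<in> V" "v \<in> V" "l u \<le> l v" for u v
  proof (rule ccontr)
    assume "\<not> r u \<le> r v"
    \<comment> \<open>The point \<open>r u\<close> lies in the larger interval only, so the
      containment is strict even when the left ends agree.\<close>
    then have "{l v..r v} \<subset> {l u..r u}" using that lr by auto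
    then show False using proper that by blast
  qed
  have "finite V" using G by (simp add: finite_simple_graph_def)
  then obtain \<sigma> where \<sigma>: "vertex_ordering V \<sigma>"
    and sorted: "\<And>u v. u \<in> V \<Longrightarrow> v \<in> V \<Longrightarrow> \<sigma> u < \<sigma> v \<Longrightarrow> l u \<le> l v"
    using finite_sorting_bijection[of V l] unfolding vertex_ordering_def by blast
  have edge_iff: "{u, v} \<in> E \<longleftrightarrow> l v \<le> r u" if "u \<in> V" "v \<in> V" "\<sigma> u < \<sigma> v" for u v
  proof -
    have "u \<noteq> v" using that by auto
    then show ?thesis
      using meet[of u v] Icc_Int_Icc_nonempty_iff[of "l u" "l v" "r u" "r v"] sorted lr that by auto
  qed
  have "{u, v} \<in> E \<and> {v, w} \<in> E"
    if V: "u \<in> V" "v \<in> V" "w \<in> V" and lt: "\<sigma> u < \<sigma> v" "\<sigma> v < \<sigma> w" and uw: "{u, w} \<in> E" for u v w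
  proof -
    have "l u \<le> l v" "l v \<le> l w" using sorted V lt by auto
    moreover have "l w \<le> r u" using edge_iff[of u w] V lt uw by auto
    moreover have "r u \<le> r v" using r_mono V \<open>l u \<le> l v\<close> by blast
    \<comment> \<open>The chain \<open>l v \<le> l w \<le> r u \<le> r v\<close> contains both
      required inequalities, \<open>l v \<le> r u\<close> and \<open>l w \<le> r v\<close>.\<close>
    ultimately show ?thesis using edge_iff V lt by auto
  qed
  with \<sigma> show ?thesis unfolding proper_interval_ordering_def by blast
qed

theorem corollary2p9:
  fixes V :: "'a set" and E :: "'a set set"
  assumes "finite_simple_graph V E"
  shows "(closed_graph V E \<longleftrightarrow> (\<exists>\<sigma>. closed_ordering V E \<sigma>)) \<and>
         ((\<exists>\<sigma>. closed_ordering V E \<sigma>) \<longleftrightarrow> (\<exists>\<sigma>. proper_interval_ordering V E \<sigma>)) \<and>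
         ((\<exists>\<sigma>. proper_interval_ordering V E \<sigma>) \<longleftrightarrow> proper_interval_graph V E)"
  using closed_graph_iff_closed_ordering[OF assms]
    closed_ordering_iff_proper_interval_ordering[OF assms]
    proper_interval_ordering_imp_proper_interval_graph[OF assms]
    proper_interval_graph_imp_proper_interval_ordering[OF assms]
  by blast

end
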